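(* The following formal power series identities in $q$ hold: $$\sum_{i,j\ge 0}\frac{q^{2i^2+6ij+6j^2}}{(q;q)_i\,(q^3;q^3)_j}=\frac{1}{(q^2,q^3,q^9,q^{10};q^{12})_\infty},$$ $$\sum_{i,j,k,l\ge 0}\frac{q^{\frac{3(i+j+k+2l)(i+j+k+2l-1)}{2}+3i+5j+\frac{3j(j-1)}{2}+k+\frac{3k(k-1)}{2}+3l}}{(q^3;q^3)_i\,(q^3;q^3)_j\,(q^3;q^3)_k\,(q^6;q^6)_l}=\sum_{i,j\ge 0}\frac{q^{2i^2+6ij+6j^2+i}}{(q;q)_i\,(q^3;q^3)_j}+\sum_{i,j\ge 0}\frac{q^{2i^2+6ij+6j^2+4i+6j+1}}{(q;q)_i\,(q^3;q^3)_j}=(-q,-q^3,-q^5,-q^6;q^6)_\infty.$$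
   Context: For $n\ge 0$, $(a;q)_n=\prod_{0\le t<n}(1-aq^t)$, $(a;q)_\infty=\prod_{t\ge 0}(1-aq^t)$, and $(a_1,\dots,a_r;q)_m=(a_1;q)_m\cdots(a_r;q)_m$ for $m$ a nonnegative integer or $\infty$. All identities are identities of formal power series. *)

theory Defs
  imports "HOL-Analysis.Analysis" "HOL-Computational_Algebra.Formal_Power_Series"
begin

definition qpochhammer :: "'a :: comm_ring_1 \<Rightarrow> 'a \<Rightarrow> nat \<Rightarrow> 'a" where
  "qpochhammer a q n = (\<Prod>t<n. 1 - a * q ^ t)"

definition qpochhammer_inf :: "'a :: {t2_space, comm_ring_1} \<Rightarrow> 'a \<Rightarrow> 'a" where
  "qpochhammer_inf a q = (\<Prod>t. 1 - a * q ^ t)"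

definition qpochhammer_infs :: "'a :: {t2_space, comm_ring_1} list \<Rightarrow> 'a \<Rightarrow> 'a" where
  "qpochhammer_infs as q = (\<Prod>a\<leftarrow>as. qpochhammer_inf a q)"

text \<open>
  The topology on formal power series is the one of coefficientwise stabilisation. The infinite
  products are not junk values of \<^const>\<open>prodinf\<close>:
\<close>

lemma has_prod_qpochhammer_inf_fps:
  fixes a q :: "'a :: idom fps"
  assumes "fps_nth a 0 = 0" "fps_nth q 0 = 0"
  shows "(\<lambda>t. 1 - a * q ^ t) has_prod qpochhammer_inf a q"
proof -
  let ?f = "\<lambda>t. 1 - a * q ^ t"
  define P where "P = (\<lambda>m. \<Prod>t\<le>m. ?f t)"
  have q: "fps_nth (q ^ m) i = 0" if "i < m" for m i
    using assms(2) that by (simp add: startsby_zero_power_prefix)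
  have aq: "fps_nth (a * q ^ m) i = 0" if "i \<le> m" for m i
    unfolding fps_mult_nth
  proof (intro sum.neutral ballI)
    fix j assume "j \<in> {0..i}"
    then show "fps_nth a j * fps_nth (q ^ m) (i - j) = 0"
      using assms(1) q[of "i - j" m] that by (cases "j = 0") auto
  qed
  have step: "fps_nth (P (Suc m)) i = fps_nth (P m) i" if "i \<le> m" for m i
  proof -
    have "P (Suc m) = P m - P m * (a * q ^ Suc m)"
      by (simp add: P_def algebra_simps)
    moreover have "fps_nth (P m * (a * q ^ Suc m)) i = 0"
      unfolding fps_mult_nth[of "P m"]
      by (intro sum.neutral ballI) (use that in \<open>simp add: aq del: power_Suc\<close>)
    ultimately show ?thesis by simp
  qed
  have stable: "fps_nth (P (n + k)) n = fps_nth (P n) n" for n k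
    by (induction k) (simp_all add: step)
  define L where "L = Abs_fps (\<lambda>n. fps_nth (P n) n)"
  have "P \<longlonglongrightarrow> L"
  proof (rule tendsto_fpsI)
    fix n
    show "eventually (\<lambda>m. fps_nth (P m) n = fps_nth L n) sequentially"
      using eventually_ge_at_top[of n]
    proof eventually_elim
      case (elim m)
      then show ?case using stable[of n "m - n"] by (simp add: L_def)
    qed
  qed
  moreover have "L \<noteq> 0"
  proof -
    have "fps_nth L 0 = 1" using assms(1) by (simp add: L_def P_def)
    then show ?thesis by auto
  qed
  ultimately have "?f has_prod L"
    by (simp add: has_prod_def raw_has_prod_def P_def)
  moreover from this have "L = qpochhammer_inf a q"
    unfolding qpochhammer_inf_def by (rule has_prod_unique)
  ultimately show ?thesis by simp
qed

end

theory Submission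
  imports Defs "HOL-Computational_Algebra.Formal_Laurent_Series"
begin

unbundle no vec_syntax
unbundle fps_syntax

text \<open>
  Write \<open>Q = q\<^sup>3\<close>, let \<open>a b = Q\<^sup>2\<close> and let \<open>c\<^sub>N\<close> be the coefficient of \<open>z\<^sup>N\<close> in
  \<open>L(z) = (-a z; Q)\<^sub>\<infinity> (-b z; Q)\<^sub>\<infinity> / ((Q z; Q)\<^sub>\<infinity> (Q z\<^sup>2; Q\<^sup>2)\<^sub>\<infinity>)\<close>. Replacing each \<open>z\<^sup>N\<close> in \<open>L\<close> by
  \<open>Q\<close> to the power \<open>N (N - 1) / 2\<close> gives a quadruple sum. Shifting two of its indices by the last
  one, summing one index by Euler's identity and another by a form of the q-Vandermonde identity turns
  it into \<open>(-Q; Q)\<^sub>\<infinity> (-a; Q\<^sup>2)\<^sub>\<infinity> (-b; Q\<^sup>2)\<^sub>\<infinity>\<close>. On the other hand, multiplying and dividing by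
  \<open>(-Q z; Q)\<^sub>\<infinity>\<close> gives \<open>L(z) = (-q\<^sup>2 z; q)\<^sub>\<infinity> / (Q z\<^sup>2; Q)\<^sub>\<infinity>\<close> if \<open>{a, b} = {q\<^sup>4, q\<^sup>2}\<close> and
  \<open>L(z) = (1 + q z) (-q\<^sup>3 z; q)\<^sub>\<infinity> / (Q z\<^sup>2; Q)\<^sub>\<infinity>\<close> if \<open>{a, b} = {q\<^sup>5, q}\<close>. Applying the same
  replacement to these expressions yields the double sums.
\<close>

section \<open>Sums of families of formal power series\<close>

text \<open>Convergence means that each coefficient of the finite partial sums is eventually
  constant; enlarging a stabilising set by one further index shows that this index contributes
  nothing. Summability is thus local finiteness in every coefficient, and the rules below reduce to
  finite sums.\<close>

lemma has_sum_fps_iff: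
  fixes f :: "'i \<Rightarrow> 'a :: comm_ring_1 fps"
  shows "(f has_sum s) A \<longleftrightarrow>
    (\<forall>n. finite {i\<in>A. f i $ n \<noteq> 0} \<and> s $ n = (\<Sum>i\<in>{i\<in>A. f i $ n \<noteq> 0}. f i $ n))"
    (is "_ \<longleftrightarrow> (\<forall>n. ?P n)")
proof -
  have "?P n \<longleftrightarrow> (\<forall>\<^sub>F F in finite_subsets_at_top A. sum f F $ n = s $ n)" for n
  proof
    assume P: "?P n"
    show "\<forall>\<^sub>F F in finite_subsets_at_top A. sum f F $ n = s $ n"
      unfolding eventually_finite_subsets_at_top
    proof (intro exI[of _ "{i\<in>A. f i $ n \<noteq> 0}"] conjI allI impI)
      fix Y assume Y: "finite Y \<and> {i\<in>A. f i $ n \<noteq> 0} \<subseteq> Y \<and> Y \<subseteq> A"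
      then show "sum f Y $ n = s $ n"
        using P by (auto simp: fps_sum_nth intro!: sum.mono_neutral_right)
    qed (use P in auto)
  next
    assume "\<forall>\<^sub>F F in finite_subsets_at_top A. sum f F $ n = s $ n"
    then obtain X where X: "finite X" "X \<subseteq> A"
      and *: "\<And>Y. finite Y \<Longrightarrow> X \<subseteq> Y \<Longrightarrow> Y \<subseteq> A \<Longrightarrow> sum f Y $ n = s $ n"
      unfolding eventually_finite_subsets_at_top by metis
    have "f i $ n = 0" if "i \<in> A" "i \<notin> X" for i
      using *[of X] *[of "insert i X"] X that by auto
    then have sub: "{i\<in>A. f i $ n \<noteq> 0} \<subseteq> X" by auto
    have "s $ n = (\<Sum>i\<in>X. f i $ n)" using *[of X] X by (simp add: fps_sum_nth)
    also have "\<dots> = (\<Sum>i\<in>{i\<in>A. f i $ n \<noteq> 0}. f i $ n)"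
      using X sub by (intro sum.mono_neutral_right) auto
    finally show "?P n" using finite_subset[OF sub] X by simp
  qed
  then show ?thesis
    by (simp add: has_sum_def tendsto_fps_iff)
qed

lemma has_sum_fps_nth:
  fixes f :: "'i \<Rightarrow> 'a :: comm_ring_1 fps"
  assumes "(f has_sum s) A" "finite F" "F \<subseteq> A" "\<And>i. i \<in> A \<Longrightarrow> i \<notin> F \<Longrightarrow> f i $ n = 0"
  shows "s $ n = (\<Sum>i\<in>F. f i $ n)"
proof -
  have "s $ n = (\<Sum>i\<in>{i\<in>A. f i $ n \<noteq> 0}. f i $ n)"
    using assms(1) by (simp add: has_sum_fps_iff)
  also have "\<dots> = (\<Sum>i\<in>F. f i $ n)"
    using assms by (intro sum.mono_neutral_left) auto
  finally show ?thesis .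
qed

lemma has_sum_fpsI:
  fixes f :: "'i \<Rightarrow> 'a :: comm_ring_1 fps"
  assumes "\<And>n. \<exists>F. finite F \<and> F \<subseteq> A \<and> (\<forall>i\<in>A - F. f i $ n = 0) \<and> s $ n = (\<Sum>i\<in>F. f i $ n)"
  shows "(f has_sum s) A"
  unfolding has_sum_fps_iff
proof
  fix n
  obtain F where F: "finite F" "F \<subseteq> A" "\<forall>i\<in>A - F. f i $ n = 0" "s $ n = (\<Sum>i\<in>F. f i $ n)"
    using assms by blast
  have sub: "{i\<in>A. f i $ n \<noteq> 0} \<subseteq> F" using F(3) by auto
  have "(\<Sum>i\<in>F. f i $ n) = (\<Sum>i\<in>{i\<in>A. f i $ n \<noteq> 0}. f i $ n)"
    using F sub by (intro sum.mono_neutral_right) auto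
  then show "finite {i\<in>A. f i $ n \<noteq> 0} \<and> s $ n = (\<Sum>i\<in>{i\<in>A. f i $ n \<noteq> 0}. f i $ n)"
    using F finite_subset[OF sub] by simp
qed

lemma has_sum_fps_unique:
  fixes f :: "'i \<Rightarrow> 'a :: comm_ring_1 fps"
  assumes "(f has_sum s) A" "(f has_sum t) A"
  shows "s = t"
  using infsumI[OF assms(1)] infsumI[OF assms(2)] by simp

lemma summable_on_fps:
  fixes f :: "'i \<Rightarrow> 'a :: comm_ring_1 fps"
  assumes "\<And>n. finite {i\<in>A. f i $ n \<noteq> 0}"
  shows "f summable_on A"
proof -
  have "(f has_sum Abs_fps (\<lambda>n. \<Sum>i\<in>{i\<in>A. f i $ n \<noteq> 0}. f i $ n)) A"
    unfolding has_sum_fps_iff using assms by simp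
  then show ?thesis unfolding summable_on_def by blast
qed

lemma has_sum_fps_add:
  fixes f g :: "'i \<Rightarrow> 'a :: comm_ring_1 fps"
  assumes "(f has_sum s) A" "(g has_sum t) A"
  shows "((\<lambda>i. f i + g i) has_sum (s + t)) A"
proof (rule has_sum_fpsI)
  fix n
  let ?F = "{i\<in>A. f i $ n \<noteq> 0} \<union> {i\<in>A. g i $ n \<noteq> 0}"
  have fin: "finite ?F" using assms by (simp add: has_sum_fps_iff)
  have "s $ n = (\<Sum>i\<in>?F. f i $ n)" "t $ n = (\<Sum>i\<in>?F. g i $ n)"
    by (rule has_sum_fps_nth[OF assms(1) fin], auto) (rule has_sum_fps_nth[OF assms(2) fin], auto)
  then show "\<exists>F. finite F \<and> F \<subseteq> A \<and> (\<forall>i\<in>A - F. (f i + g i) $ n = 0) \<and>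
      (s + t) $ n = (\<Sum>i\<in>F. (f i + g i) $ n)"
    using fin by (intro exI[of _ ?F]) (auto simp: sum.distrib)
qed

text \<open>Coefficient \<open>n\<close> of a product involves only coefficients up to
  \<open>n\<close>, so the finite union of the supports at orders \<open>m \<le> n\<close> serves
  for all of them at once.\<close>

lemma has_sum_fps_cmult:
  fixes f :: "'i \<Rightarrow> 'a :: comm_ring_1 fps"
  assumes "(f has_sum s) A"
  shows "((\<lambda>i. c * f i) has_sum (c * s)) A"
proof (rule has_sum_fpsI)
  fix n
  let ?F = "\<Union>m\<in>{..n}. {i\<in>A. f i $ m \<noteq> 0}"
  have fin: "finite ?F" using assms by (simp add: has_sum_fps_iff)
  have s: "s $ m = (\<Sum>i\<in>?F. f i $ m)" if "m \<le> n" for m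
    by (rule has_sum_fps_nth[OF assms fin]) (use that in auto)
  have "(c * s) $ n = (\<Sum>i\<in>?F. (c * f i) $ n)"
    by (simp add: fps_mult_nth s sum_distrib_left sum.swap[of _ ?F])
  moreover have "\<forall>i\<in>A - ?F. (c * f i) $ n = 0"
    by (auto simp: fps_mult_nth intro!: sum.neutral)
  ultimately show "\<exists>F. finite F \<and> F \<subseteq> A \<and> (\<forall>i\<in>A - F. (c * f i) $ n = 0) \<and>
      (c * s) $ n = (\<Sum>i\<in>F. (c * f i) $ n)"
    using fin by (intro exI[of _ ?F] conjI) auto
qed

text \<open>A Fubini rule: at each order the finite support splits into finite fibres over its first
  projection.\<close>

lemma has_sum_fps_Sigma:
  fixes f :: "'i \<times> 'j \<Rightarrow> 'a :: comm_ring_1 fps"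
  assumes "(f has_sum s) (Sigma A B)" "\<And>x. x \<in> A \<Longrightarrow> ((\<lambda>y. f (x, y)) has_sum b x) (B x)"
  shows "(b has_sum s) A"
proof (rule has_sum_fpsI)
  fix n
  let ?S = "{p\<in>Sigma A B. f p $ n \<noteq> 0}" and ?T = "\<lambda>x. {y\<in>B x. f (x, y) $ n \<noteq> 0}"
  have fin: "finite ?S" and s: "s $ n = (\<Sum>p\<in>?S. f p $ n)"
    using assms(1) by (simp_all add: has_sum_fps_iff)
  have finT: "finite (?T x)" and b: "b x $ n = (\<Sum>y\<in>?T x. f (x, y) $ n)" if "x \<in> A" for x
    using assms(2)[OF that] by (simp_all add: has_sum_fps_iff)
  have "?S = Sigma (fst ` ?S) ?T" by force
  then have "s $ n = (\<Sum>p\<in>Sigma (fst ` ?S) ?T. f p $ n)" using s by simp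
  also have "\<dots> = (\<Sum>x\<in>fst ` ?S. \<Sum>y\<in>?T x. f (x, y) $ n)"
    using fin finT by (subst sum.Sigma) (auto simp: case_prod_unfold)
  also have "\<dots> = (\<Sum>x\<in>fst ` ?S. b x $ n)"
    by (intro sum.cong refl) (auto simp: b)
  finally have "s $ n = (\<Sum>x\<in>fst ` ?S. b x $ n)" .
  moreover have "b x $ n = 0" if "x \<in> A - fst ` ?S" for x
  proof -
    have "?T x = {}" using that by force
    then show ?thesis using b[of x] that by simp
  qed
  ultimately show "\<exists>F. finite F \<and> F \<subseteq> A \<and> (\<forall>x\<in>A - F. b x $ n = 0) \<and> s $ n = (\<Sum>x\<in>F. b x $ n)"
    using fin by (intro exI[of _ "fst ` ?S"] conjI) auto
qed

text \<open>A nonzero coefficient \<open>n\<close> of \<open>f i * g j\<close> forces nonzero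
  coefficients of \<open>f i\<close> at some \<open>m \<le> n\<close> and of \<open>g j\<close> at
  \<open>n - m\<close>, which leaves finitely many pairs. The value then follows by summing over
  \<open>j\<close> first.\<close>

lemma has_sum_fps_times:
  fixes f :: "'i \<Rightarrow> 'a :: comm_ring_1 fps" and g :: "'j \<Rightarrow> 'a fps"
  assumes "(f has_sum s) A" "(g has_sum t) B"
  shows "((\<lambda>(i, j). f i * g j) has_sum (s * t)) (A \<times> B)"
proof -
  have "(\<lambda>(i, j). f i * g j) summable_on (A \<times> B)"
  proof (rule summable_on_fps)
    fix n
    have "{p\<in>A \<times> B. (case p of (i, j) \<Rightarrow> f i * g j) $ n \<noteq> 0}
      \<subseteq> (\<Union>m\<in>{..n}. {i\<in>A. f i $ m \<noteq> 0} \<times> {j\<in>B. g j $ (n - m) \<noteq> 0})" (is "_ \<subseteq> ?R")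
    proof
      fix p assume p: "p \<in> {p\<in>A \<times> B. (case p of (i, j) \<Rightarrow> f i * g j) $ n \<noteq> 0}"
      obtain i j where ij: "p = (i, j)" by force
      have "(\<Sum>m=0..n. f i $ m * g j $ (n - m)) \<noteq> 0"
        using p ij by (simp add: fps_mult_nth)
      then obtain m where "m \<in> {0..n}" "f i $ m * g j $ (n - m) \<noteq> 0"
        by (rule sum.not_neutral_contains_not_neutral)
      then have "m \<le> n" "f i $ m \<noteq> 0" "g j $ (n - m) \<noteq> 0" by auto
      then show "p \<in> ?R" using p ij by auto
    qed
    moreover have "finite ?R" using assms by (simp add: has_sum_fps_iff)
    ultimately show "finite {p\<in>A \<times> B. (case p of (i, j) \<Rightarrow> f i * g j) $ n \<noteq> 0}"
      by (rule finite_subset)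
  qed
  then obtain u where u: "((\<lambda>(i, j). f i * g j) has_sum u) (A \<times> B)"
    unfolding summable_on_def by blast
  have "((\<lambda>i. t * f i) has_sum u) A"
    by (rule has_sum_fps_Sigma[OF u]) (simp add: has_sum_fps_cmult[OF assms(2)] mult.commute[of t])
  moreover have "((\<lambda>i. t * f i) has_sum (t * s)) A"
    by (rule has_sum_fps_cmult[OF assms(1)])
  ultimately have "u = t * s" by (rule has_sum_fps_unique)
  then show ?thesis using u by (simp add: mult.commute)
qed

lemma fps_tendsto_mult:
  fixes f g :: "'i \<Rightarrow> 'a :: comm_ring_1 fps"
  assumes "(f \<longlongrightarrow> a) F" "(g \<longlongrightarrow> b) F"
  shows "((\<lambda>x. f x * g x) \<longlongrightarrow> a * b) F"
proof (rule tendsto_fpsI)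
  fix n
  have "\<forall>\<^sub>F x in F. \<forall>m\<in>{..n}. f x $ m = a $ m" "\<forall>\<^sub>F x in F. \<forall>m\<in>{..n}. g x $ m = b $ m"
    using assms by (auto intro!: eventually_ball_finite simp: tendsto_fps_iff)
  then show "\<forall>\<^sub>F x in F. (f x * g x) $ n = (a * b) $ n"
    by eventually_elim (simp add: fps_mult_nth)
qed

section \<open>Pochhammer symbols and Euler's identity\<close>

lemma fps_X_dvd_iff: "fps_X dvd f \<longleftrightarrow> f $ 0 = 0" for f :: "'a :: comm_ring_1 fps"
proof
  assume "f $ 0 = 0"
  then have "f = fps_X * Abs_fps (\<lambda>n. f $ Suc n)"
    by (auto simp: fps_eq_iff)
  then show "fps_X dvd f" by (rule dvdI)
qed (auto elim!: dvdE)

lemma fps_X_power_dvd_power: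
  fixes f :: "'a :: comm_ring_1 fps"
  assumes "f $ 0 = 0" "m \<le> n"
  shows "fps_X ^ m dvd f ^ n"
proof (rule dvd_trans)
  show "fps_X ^ m dvd f ^ m"
    by (rule dvd_power_same) (simp add: fps_X_dvd_iff assms)
  show "f ^ m dvd f ^ n"
    by (rule le_imp_power_dvd) (rule assms)
qed

lemma fps_X_power_dvd_nth:
  fixes f :: "'a :: comm_ring_1 fps"
  assumes "fps_X ^ n dvd f" "m < n"
  shows "f $ m = 0"
  using assms by (auto elim!: dvdE simp: fps_X_power_mult_nth)

text \<open>Only the indices with \<open>w i \<le> n\<close> can contribute to coefficient
  \<open>n\<close>.\<close>

lemma summable_on_fps_dvd:
  fixes f :: "'i \<Rightarrow> 'a :: comm_ring_1 fps"
  assumes "\<And>i. i \<in> A \<Longrightarrow> fps_X ^ w i dvd f i" "\<And>n. finite {i\<in>A. w i \<le> n}"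
  shows "f summable_on A"
proof (rule summable_on_fps)
  fix n
  have "{i\<in>A. f i $ n \<noteq> 0} \<subseteq> {i\<in>A. w i \<le> n}"
    using fps_X_power_dvd_nth[OF assms(1)] by (auto simp: not_less[symmetric])
  then show "finite {i\<in>A. f i $ n \<noteq> 0}"
    using assms(2) by (rule finite_subset)
qed

lemma qpochhammer_0 [simp]: "qpochhammer a q 0 = 1"
  by (simp add: qpochhammer_def)

lemma qpochhammer_Suc: "qpochhammer a q (Suc n) = qpochhammer a q n * (1 - a * q ^ n)"
  by (simp add: qpochhammer_def)

lemma qpochhammer_add:
  "qpochhammer a q (m + n) = qpochhammer a q m * qpochhammer (a * q ^ m) q n"
  by (induction n) (simp_all add: qpochhammer_Suc power_add mult_ac)

lemma qpochhammer_even_odd: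
  "qpochhammer a q (2 * n) = qpochhammer a (q ^ 2) n * qpochhammer (a * q) (q ^ 2) n"
  by (induction n) (simp_all add: qpochhammer_Suc power_mult [symmetric] mult_ac)

lemma qpochhammer_times_uminus:
  "qpochhammer a q n * qpochhammer (- a) q n = qpochhammer (a ^ 2) (q ^ 2) n"
proof (induction n)
  case (Suc n)
  have "qpochhammer a q (Suc n) * qpochhammer (- a) q (Suc n) =
    (qpochhammer a q n * qpochhammer (- a) q n) * ((1 - a * q ^ n) * (1 + a * q ^ n))"
    by (simp add: qpochhammer_Suc mult_ac)
  also have "(1 - a * q ^ n) * (1 + a * q ^ n) = 1 - a ^ 2 * (q ^ 2) ^ n"
    by (simp add: algebra_simps power2_eq_square power_mult_distrib)
  finally show ?case by (simp add: Suc qpochhammer_Suc)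
qed simp

lemma qpochhammer_nth_0 [simp]:
  fixes a q :: "'a :: comm_ring_1 fps"
  assumes "a $ 0 = 0"
  shows "qpochhammer a q n $ 0 = 1"
  by (induction n) (simp_all add: qpochhammer_Suc assms)

lemma qpochhammer_inf_LIMSEQ:
  fixes a q :: "'a :: idom fps"
  assumes "a $ 0 = 0" "q $ 0 = 0"
  shows "qpochhammer a q \<longlonglongrightarrow> qpochhammer_inf a q"
proof -
  \<comment> \<open>\<open>has_prod\<close> has a separate case for products with vanishing factors.
    Constant term 1 rules it out, so the product is the limit of the plain partial products.\<close>
  have "(1 - a * q ^ t) $ 0 = 1" for t using assms by simp
  then have "1 - a * q ^ t \<noteq> 0" for t by (metis fps_zero_nth zero_neq_one)
  then have "(\<lambda>n. \<Prod>t\<le>n. 1 - a * q ^ t) \<longlonglongrightarrow> qpochhammer_inf a q"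
    using has_prod_qpochhammer_inf_fps[OF assms] by (simp add: has_prod_def raw_has_prod_def)
  then have "(\<lambda>n. qpochhammer a q (Suc n)) \<longlonglongrightarrow> qpochhammer_inf a q"
    by (simp add: qpochhammer_def lessThan_Suc_atMost)
  then show ?thesis by (rule LIMSEQ_imp_Suc)
qed

lemma qpochhammer_inf_nth_0:
  fixes a q :: "'a :: idom fps"
  assumes "a $ 0 = 0" "q $ 0 = 0"
  shows "qpochhammer_inf a q $ 0 = 1"
proof -
  have "\<forall>\<^sub>F n in sequentially. qpochhammer a q n $ 0 = qpochhammer_inf a q $ 0"
    using qpochhammer_inf_LIMSEQ[OF assms] by (simp add: tendsto_fps_iff)
  then show ?thesis using assms by simp
qed

lemma qpochhammer_inf_nonzero:
  fixes a q :: "'a :: idom fps"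
  assumes "a $ 0 = 0" "q $ 0 = 0"
  shows "qpochhammer_inf a q \<noteq> 0"
  using qpochhammer_inf_nth_0[OF assms] by auto

lemma qpochhammer_inf_shift:
  fixes a q :: "'a :: idom fps"
  assumes "a $ 0 = 0" "q $ 0 = 0"
  shows "qpochhammer_inf a q = qpochhammer a q n * qpochhammer_inf (a * q ^ n) q"
proof (rule LIMSEQ_unique)
  show "(\<lambda>m. qpochhammer a q (m + n)) \<longlonglongrightarrow> qpochhammer_inf a q"
    by (rule LIMSEQ_ignore_initial_segment) (rule qpochhammer_inf_LIMSEQ[OF assms])
  show "(\<lambda>m. qpochhammer a q (m + n)) \<longlonglongrightarrow> qpochhammer a q n * qpochhammer_inf (a * q ^ n) q"
    unfolding add.commute[of _ n] qpochhammer_add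
    by (intro fps_tendsto_mult tendsto_const qpochhammer_inf_LIMSEQ) (use assms in auto)
qed

lemma qpochhammer_inf_even_odd:
  fixes a q :: "'a :: idom fps"
  assumes "a $ 0 = 0" "q $ 0 = 0"
  shows "qpochhammer_inf a q = qpochhammer_inf a (q ^ 2) * qpochhammer_inf (a * q) (q ^ 2)"
proof (rule LIMSEQ_unique)
  show "(\<lambda>n. qpochhammer a q (2 * n)) \<longlonglongrightarrow> qpochhammer_inf a q"
    using LIMSEQ_subseq_LIMSEQ[OF qpochhammer_inf_LIMSEQ[OF assms], of "\<lambda>n. 2 * n"]
    by (simp add: o_def strict_mono_def)
  show "(\<lambda>n. qpochhammer a q (2 * n)) \<longlonglongrightarrow>
      qpochhammer_inf a (q ^ 2) * qpochhammer_inf (a * q) (q ^ 2)"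
    unfolding qpochhammer_even_odd
    by (intro fps_tendsto_mult qpochhammer_inf_LIMSEQ) (use assms in \<open>auto simp: power2_eq_square\<close>)
qed

lemma qpochhammer_inf_times_uminus:
  fixes a q :: "'a :: idom fps"
  assumes "a $ 0 = 0" "q $ 0 = 0"
  shows "qpochhammer_inf a q * qpochhammer_inf (- a) q = qpochhammer_inf (a ^ 2) (q ^ 2)"
proof (rule LIMSEQ_unique)
  show "(\<lambda>n. qpochhammer (a ^ 2) (q ^ 2) n) \<longlonglongrightarrow> qpochhammer_inf a q * qpochhammer_inf (- a) q"
    unfolding qpochhammer_times_uminus[symmetric]
    by (intro fps_tendsto_mult qpochhammer_inf_LIMSEQ) (use assms in auto)
  show "(\<lambda>n. qpochhammer (a ^ 2) (q ^ 2) n) \<longlonglongrightarrow> qpochhammer_inf (a ^ 2) (q ^ 2)"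
    by (intro qpochhammer_inf_LIMSEQ) (use assms in \<open>auto simp: power2_eq_square\<close>)
qed

section \<open>Reciprocal q-factorials and Euler's expansion of (-x; q)_inf\<close>

definition inv_qfact :: "'a :: field fps \<Rightarrow> nat \<Rightarrow> 'a fps" where
  "inv_qfact q n = inverse (qpochhammer q q n)"

lemma qpochhammer_times_inv_qfact:
  assumes "q $ 0 = 0"
  shows "qpochhammer q q n * inv_qfact q n = 1"
  unfolding inv_qfact_def using assms
  by (metis inverse_mult_eq_1' qpochhammer_nth_0 zero_neq_one)

lemma inv_qfact_0 [simp]: "inv_qfact q 0 = 1"
  by (simp add: inv_qfact_def)

lemma inv_qfact_Suc:
  assumes "q $ 0 = 0"
  shows "(1 - q ^ Suc n) * inv_qfact q (Suc n) = inv_qfact q n"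
proof -
  let ?p = "qpochhammer q q n"
  have "inv_qfact q n = (?p * inv_qfact q n) * ((1 - q ^ Suc n) * inv_qfact q (Suc n))"
    using qpochhammer_times_inv_qfact[OF assms, of "Suc n"]
    by (simp add: qpochhammer_Suc mult_ac)
  then show ?thesis by (simp add: qpochhammer_times_inv_qfact[OF assms])
qed

text \<open>The summand of Euler's expansion of (-x; q)_inf. Writing the exponent n (n - 1) / 2 as a
  binomial coefficient keeps division out of the exponents.\<close>

definition euler_term :: "'a :: field fps \<Rightarrow> 'a fps \<Rightarrow> nat \<Rightarrow> 'a fps" where
  "euler_term q x n = q ^ (n choose 2) * x ^ n * inv_qfact q n"

lemma euler_term_0 [simp]: "euler_term q x 0 = 1"
  by (simp add: euler_term_def binomial_eq_0)

lemma Suc_choose_2: "Suc n choose 2 = (n choose 2) + n"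
  by (simp add: numeral_2_eq_2)

lemma add_choose_2: "(m + n) choose 2 = (m choose 2) + (n choose 2) + m * n"
  by (induction n) (simp_all add: Suc_choose_2 del: binomial_Suc_Suc)

lemma euler_term_dvd:
  assumes "x $ 0 = 0" "m \<le> n"
  shows "fps_X ^ m dvd euler_term q x n"
  unfolding euler_term_def
  by (intro dvd_mult dvd_mult2 fps_X_power_dvd_power assms)

text \<open>Termwise form of (-x; q)_inf = (1 + x) (-x q; q)_inf: the difference produces the factor
  \<open>1 - q ^ Suc n\<close>, which cancels the last factor of (q; q)_(n+1).\<close>

lemma euler_term_Suc:
  assumes "q $ 0 = 0"
  shows "euler_term q x (Suc n) - euler_term q (x * q) (Suc n) = x * euler_term q (x * q) n"
proof -
  have "euler_term q x (Suc n) - euler_term q (x * q) (Suc n) =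
    q ^ (Suc n choose 2) * x ^ Suc n * ((1 - q ^ Suc n) * inv_qfact q (Suc n))"
    unfolding euler_term_def power_mult_distrib by (simp add: algebra_simps)
  also have "\<dots> = x * euler_term q (x * q) n"
    unfolding inv_qfact_Suc[OF assms] Suc_choose_2
    by (simp add: euler_term_def power_add power_mult_distrib mult_ac)
  finally show ?thesis .
qed

text \<open>The sum S satisfies S(y) = (1 + y) S(y q). Iteration splits off the finite products, and
  S(x q^n) tends to 1 because x q^n tends to 0.\<close>

lemma euler_has_sum:
  fixes x q :: "'a :: field fps"
  assumes "x $ 0 = 0" "q $ 0 = 0"
  shows "(euler_term q x has_sum qpochhammer_inf (- x) q) UNIV"
proof -
  define S where "S y = infsum (euler_term q y) UNIV" for y
  have S: "(euler_term q y has_sum S y) UNIV" if "y $ 0 = 0" for y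
  proof -
    have "euler_term q y summable_on UNIV"
      by (rule summable_on_fps_dvd[where w = "\<lambda>n. n"]) (use that in \<open>auto intro: euler_term_dvd\<close>)
    then show ?thesis unfolding S_def by (rule has_sum_infsum)
  qed
  have step: "S y = (1 + y) * S (y * q)" if "y $ 0 = 0" for y
  proof -
    \<comment> \<open>The terms of y S(y q) moved up by one place, with 0 at index 0, so that they
      can be added termwise to those of S(y q).\<close>
    define g where "g n = (case n of 0 \<Rightarrow> 0 | Suc n \<Rightarrow> y * euler_term q (y * q) n)" for n
    have "((\<lambda>n. y * euler_term q (y * q) n) has_sum (y * S (y * q))) UNIV"
      by (intro has_sum_fps_cmult S) (simp add: that)
    then have "(g has_sum (y * S (y * q))) (range Suc)"
      by (subst has_sum_reindex) (simp_all add: g_def o_def)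
    then have "(g has_sum (y * S (y * q))) UNIV"
      by (subst has_sum_cong_neutral[where T = "range Suc" and g = g])
        (auto simp: g_def split: nat.splits)
    then have "((\<lambda>n. euler_term q (y * q) n + g n) has_sum (S (y * q) + y * S (y * q))) UNIV"
      by (intro has_sum_fps_add S) (simp_all add: that)
    moreover have "euler_term q (y * q) n + g n = euler_term q y n" for n
      using euler_term_Suc[OF assms(2), of y]
      by (cases n) (auto simp: g_def euler_term_def algebra_simps)
    ultimately have "(euler_term q y has_sum (S (y * q) + y * S (y * q))) UNIV" by simp
    then have "S y = S (y * q) + y * S (y * q)"
      by (rule has_sum_fps_unique[OF S[OF that]])
    then show ?thesis by (simp add: algebra_simps)
  qed
  have S_eq: "S x = qpochhammer (- x) q n * S (x * q ^ n)" for n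
  proof (induction n)
    case (Suc n)
    show ?case
      using Suc step[of "x * q ^ n"] assms(1) by (simp add: qpochhammer_Suc mult_ac)
  qed simp
  have "(\<lambda>n. S (x * q ^ n)) \<longlonglongrightarrow> 1"
  proof (rule tendsto_fpsI)
    fix m
    have "S (x * q ^ n) $ m = 1 $ m" if "m < n" for n
    proof -
      have dvd: "fps_X ^ n dvd x * q ^ n"
        by (intro dvd_mult fps_X_power_dvd_power) (use assms in auto)
      \<comment> \<open>Every term except the one at index 0 is divisible by
        \<open>fps_X ^ n\<close>, hence invisible at order \<open>m < n\<close>.\<close>
      have "S (x * q ^ n) $ m = (\<Sum>i\<in>{0}. euler_term q (x * q ^ n) i $ m)"
      proof (rule has_sum_fps_nth[OF S])
        fix i :: nat assume "i \<notin> {0}"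
        then have "x * q ^ n dvd (x * q ^ n) ^ i" by (cases i) auto
        then have "fps_X ^ n dvd euler_term q (x * q ^ n) i"
          unfolding euler_term_def by (intro dvd_mult dvd_mult2 dvd_trans[OF dvd])
        then show "euler_term q (x * q ^ n) i $ m = 0"
          using that by (rule fps_X_power_dvd_nth)
      qed (use assms in auto)
      then show ?thesis by simp
    qed
    then show "\<forall>\<^sub>F n in sequentially. S (x * q ^ n) $ m = 1 $ m"
      by (intro eventually_mono[OF eventually_gt_at_top[of m]])
  qed
  then have "(\<lambda>n. qpochhammer (- x) q n * S (x * q ^ n)) \<longlonglongrightarrow> qpochhammer_inf (- x) q * 1"
    by (intro fps_tendsto_mult qpochhammer_inf_LIMSEQ) (use assms in auto)
  then have "(\<lambda>n::nat. S x) \<longlonglongrightarrow> qpochhammer_inf (- x) q" by (simp add: S_eq[symmetric])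
  then have "S x = qpochhammer_inf (- x) q" by (simp add: LIMSEQ_const_iff)
  then show ?thesis using S[OF assms(1)] by simp
qed

section \<open>A q-Vandermonde identity\<close>

text \<open>The part of the quadruple sum that depends on l once J = j + l and K = k + l are fixed.
  The guard returns 0 where truncated subtraction would give spurious values.\<close>

definition vandermonde_term :: "'a :: field fps \<Rightarrow> nat \<Rightarrow> nat \<Rightarrow> nat \<Rightarrow> 'a fps" where
  "vandermonde_term q J K l = (if l \<le> J \<and> l \<le> K then
     q ^ ((J - l) * (K - l)) * inv_qfact q (J - l) * inv_qfact q (K - l) * inv_qfact (q ^ 2) l else 0)"

text \<open>With j = J - l the multiplier is
  \<open>q ^ (2 * l) * (1 - q ^ Suc j) * (1 + q ^ Suc j)\<close>, and its middle factor cancels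
  against (q; q)_(j+1). At the boundary \<open>l = Suc J\<close> the multiplier itself
  vanishes.\<close>

lemma vandermonde_term_split_left:
  assumes "q $ 0 = 0"
  shows "(q ^ (2 * l) - q ^ (2 * J + 2)) * vandermonde_term q (Suc J) K l =
    (q ^ (K + l) + q ^ (J + K + 1)) * vandermonde_term q J K l"
proof (cases "l \<le> J \<and> l \<le> K")
  case True
  then obtain j k where jk: "J = l + j" "K = l + k" by (auto simp: le_iff_add)
  have "(q ^ (2 * l) - q ^ (2 * J + 2)) * vandermonde_term q (Suc J) K l =
    q ^ (2 * l) * (1 + q ^ Suc j) * q ^ (Suc j * k) * ((1 - q ^ Suc j) * inv_qfact q (Suc j))
      * inv_qfact q k * inv_qfact (q ^ 2) l"
    by (simp add: vandermonde_term_def jk Suc_diff_le algebra_simps power_add mult_2 mult_2_right)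
  also have "\<dots> = (q ^ (K + l) + q ^ (J + K + 1)) * vandermonde_term q J K l"
    unfolding inv_qfact_Suc[OF assms]
    by (simp add: vandermonde_term_def jk algebra_simps power_add mult_2 mult_2_right)
  finally show ?thesis .
next
  case False
  then consider "l = Suc J" | "l > Suc J" | "l > K" by linarith
  then show ?thesis by cases (auto simp: vandermonde_term_def)
qed

lemma vandermonde_term_split_right:
  assumes "q $ 0 = 0"
  shows "(q ^ l - q ^ Suc K) * vandermonde_term q J (Suc K) l = q ^ J * vandermonde_term q J K l"
proof (cases "l \<le> J \<and> l \<le> K")
  case True
  then obtain j k where jk: "J = l + j" "K = l + k" by (auto simp: le_iff_add)
  have "(q ^ l - q ^ Suc K) * vandermonde_term q J (Suc K) l =
    q ^ l * q ^ (j * Suc k) * inv_qfact q j * ((1 - q ^ Suc k) * inv_qfact q (Suc k)) * inv_qfact (q ^ 2) l"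
    by (simp add: vandermonde_term_def jk Suc_diff_le algebra_simps power_add)
  also have "\<dots> = q ^ J * vandermonde_term q J K l"
    unfolding inv_qfact_Suc[OF assms]
    by (simp add: vandermonde_term_def jk algebra_simps power_add)
  finally show ?thesis .
next
  case False
  then consider "l = Suc K" | "l > Suc K" | "l > J" by linarith
  then show ?thesis by cases (auto simp: vandermonde_term_def)
qed

lemma inv_qfact_power2_Suc:
  assumes "q $ 0 = 0"
  shows "(1 - q ^ (2 * n + 2)) * inv_qfact (q ^ 2) (Suc n) = inv_qfact (q ^ 2) n"
proof -
  have "q ^ (2 * n + 2) = (q ^ 2) ^ Suc n"
    unfolding power_mult[symmetric] by simp
  then show ?thesis
    using inv_qfact_Suc[of "q ^ 2" n] assms by (simp add: power2_eq_square del: power_Suc)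
qed

text \<open>Split \<open>1 - q ^ (2 * J + 2)\<close> at \<open>q ^ (2 * l)\<close>. The first part
  cancels the last factor of (q^2; q^2)_l and lowers all three indices; the second lowers J and
  leaves a power \<open>q ^ l\<close>, which \<open>vandermonde_term_split_right\<close> removes.
  The resulting coefficients are free of l, so the relation can be summed over l.\<close>

lemma vandermonde_term_Suc_Suc:
  assumes "q $ 0 = 0"
  shows "(1 - q ^ (2 * J + 2)) * vandermonde_term q (Suc J) (Suc K) l =
    (case l of 0 \<Rightarrow> 0 | Suc l \<Rightarrow> vandermonde_term q J K l)
    + (q ^ (2 * K + 2) + q ^ (J + K + 2)) * vandermonde_term q J (Suc K) l
    + q ^ (J + K + 1) * vandermonde_term q J K l"
proof -
  let ?F = "vandermonde_term q"
  have 1: "(1 - q ^ (2 * l)) * ?F (Suc J) (Suc K) l = (case l of 0 \<Rightarrow> 0 | Suc l \<Rightarrow> ?F J K l)"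
  proof (cases l)
    case (Suc m)
    have "(1 - q ^ (2 * l)) * ?F (Suc J) (Suc K) l = (if m \<le> J \<and> m \<le> K then
        q ^ ((J - m) * (K - m)) * inv_qfact q (J - m) * inv_qfact q (K - m)
          * ((1 - q ^ (2 * m + 2)) * inv_qfact (q ^ 2) (Suc m)) else 0)"
      by (simp add: vandermonde_term_def Suc)
    then show ?thesis
      unfolding inv_qfact_power2_Suc[OF assms] by (simp add: vandermonde_term_def Suc)
  qed simp
  have 2: "(q ^ (2 * l) - q ^ (2 * J + 2)) * ?F (Suc J) (Suc K) l =
      (q ^ Suc K * q ^ l + q ^ (J + K + 2)) * ?F J (Suc K) l"
    using vandermonde_term_split_left[OF assms, of l J "Suc K"] by (simp add: power_add)
  have 3: "q ^ l * ?F J (Suc K) l = q ^ Suc K * ?F J (Suc K) l + q ^ J * ?F J K l"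
    using vandermonde_term_split_right[OF assms, of l K J] by (simp add: algebra_simps)
  have "(1 - q ^ (2 * J + 2)) * ?F (Suc J) (Suc K) l =
      (1 - q ^ (2 * l)) * ?F (Suc J) (Suc K) l + (q ^ (2 * l) - q ^ (2 * J + 2)) * ?F (Suc J) (Suc K) l"
    by (simp add: algebra_simps)
  also have "\<dots> = (case l of 0 \<Rightarrow> 0 | Suc l \<Rightarrow> ?F J K l)
      + (q ^ Suc K * (q ^ l * ?F J (Suc K) l) + q ^ (J + K + 2) * ?F J (Suc K) l)"
    unfolding 1 2 by (simp add: algebra_simps)
  also have "\<dots> = (case l of 0 \<Rightarrow> 0 | Suc l \<Rightarrow> ?F J K l)
    + (q ^ (2 * K + 2) + q ^ (J + K + 2)) * ?F J (Suc K) l + q ^ (J + K + 1) * ?F J K l"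
    unfolding 3 by (simp add: algebra_simps power_add mult_2 mult_2_right power2_eq_square)
  finally show ?thesis .
qed

lemma inv_qfact_square:
  assumes "q $ 0 = 0"
  shows "inv_qfact q n = qpochhammer (- q) q n * inv_qfact (q ^ 2) n"
proof -
  have "inv_qfact q n = inv_qfact q n * (qpochhammer (q ^ 2) (q ^ 2) n * inv_qfact (q ^ 2) n)"
    using assms by (subst qpochhammer_times_inv_qfact) (simp_all add: power2_eq_square)
  also have "\<dots> = (qpochhammer q q n * inv_qfact q n) * (qpochhammer (- q) q n * inv_qfact (q ^ 2) n)"
    by (simp add: qpochhammer_times_uminus[symmetric] mult_ac)
  finally show ?thesis by (simp add: qpochhammer_times_inv_qfact[OF assms])
qed

text \<open>Both sides satisfy the recurrence obtained by summing
  \<open>vandermonde_term_Suc_Suc\<close> over l, and they agree when J or K is 0, where only l = 0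
  contributes.\<close>

lemma sum_vandermonde_term:
  assumes "q $ 0 = 0"
  shows "(\<Sum>l\<le>J. vandermonde_term q J K l) =
    qpochhammer (- q) q (J + K) * inv_qfact (q ^ 2) J * inv_qfact (q ^ 2) K"
proof (induction J arbitrary: K)
  case 0
  show ?case by (simp add: vandermonde_term_def inv_qfact_square[OF assms])
next
  case (Suc J)
  let ?F = "vandermonde_term q" and ?p = "qpochhammer (- q) q" and ?v = "inv_qfact (q ^ 2)"
  show ?case
  proof (cases K)
    case 0
    have "(\<Sum>l\<le>Suc J. ?F (Suc J) 0 l) = (\<Sum>l\<in>{0}. ?F (Suc J) 0 l)"
      by (intro sum.mono_neutral_right) (auto simp: vandermonde_term_def)
    then show ?thesis
      using 0 by (simp add: vandermonde_term_def inv_qfact_square[OF assms])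
  next
    case (Suc K')
    let ?K = "Suc K'"
    note vS = inv_qfact_power2_Suc[OF assms]
    have ext: "(\<Sum>l\<le>Suc J. ?F J K l) = (\<Sum>l\<le>J. ?F J K l)" for K
      by (simp add: vandermonde_term_def)
    have "(1 - q ^ (2 * J + 2)) * (\<Sum>l\<le>Suc J. ?F (Suc J) ?K l) =
        (\<Sum>l\<le>Suc J. case l of 0 \<Rightarrow> 0 | Suc l \<Rightarrow> ?F J K' l)
        + (q ^ (2 * K' + 2) + q ^ (J + K' + 2)) * (\<Sum>l\<le>Suc J. ?F J ?K l)
        + q ^ (J + K' + 1) * (\<Sum>l\<le>Suc J. ?F J K' l)"
      unfolding sum_distrib_left vandermonde_term_Suc_Suc[OF assms] sum.distrib ..
    also have "(\<Sum>l\<le>Suc J. case l of 0 \<Rightarrow> 0 | Suc l \<Rightarrow> ?F J K' l) = (\<Sum>l\<le>J. ?F J K' l)"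
      by (simp add: sum.atMost_Suc_shift del: sum.atMost_Suc)
    also have "(\<Sum>l\<le>J. ?F J K' l)
        + (q ^ (2 * K' + 2) + q ^ (J + K' + 2)) * (\<Sum>l\<le>Suc J. ?F J ?K l)
        + q ^ (J + K' + 1) * (\<Sum>l\<le>Suc J. ?F J K' l)
      = ?p (J + K') * ?v J * ((1 - q ^ (2 * K' + 2)) * ?v ?K)
        + (q ^ (2 * K' + 2) + q ^ (J + K' + 2)) * (?p (J + ?K) * ?v J * ?v ?K)
        + q ^ (J + K' + 1) * (?p (J + K') * ?v J * ((1 - q ^ (2 * K' + 2)) * ?v ?K))"
      unfolding ext Suc.IH vS ..
    \<comment> \<open>The first and third summands combine to \<open>1 - q ^ (2 * ?K)\<close> times
      \<open>?p (J + ?K)\<close>. Together with the second they leave the factor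
      \<open>1 + q ^ (J + ?K + 1)\<close>, which extends the Pochhammer symbol by one.\<close>
    also have "\<dots> = ?p (Suc J + ?K) * ?v J * ?v ?K"
      by (simp add: qpochhammer_Suc algebra_simps power_add mult_2 mult_2_right)
    also have "\<dots> = (1 - q ^ (2 * J + 2)) * (?p (Suc J + ?K) * ?v (Suc J) * ?v ?K)"
      by (subst vS[of J, symmetric]) (simp add: mult_ac)
    finally have eq: "(1 - q ^ (2 * J + 2)) * (\<Sum>l\<le>Suc J. ?F (Suc J) ?K l) =
      (1 - q ^ (2 * J + 2)) * (?p (Suc J + ?K) * ?v (Suc J) * ?v ?K)" .
    have "(1 - q ^ (2 * J + 2)) $ 0 \<noteq> 0" using assms by simp
    then have "1 - q ^ (2 * J + 2) \<noteq> 0" by (metis fps_zero_nth)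
    then show ?thesis using eq Suc by (metis mult_left_cancel)
  qed
qed

section \<open>Generating series in the auxiliary variable\<close>

lemma euler_term_scale: "euler_term q (x * c) n = c ^ n * euler_term q x n"
  by (simp add: euler_term_def power_mult_distrib mult_ac)

text \<open>The substitution of c z for z, where z is the outer variable. Stating it as a
  composition yields multiplicativity.\<close>

definition dilate :: "'b \<Rightarrow> 'b :: comm_ring_1 fps \<Rightarrow> 'b fps" where
  "dilate c F = F oo (fps_const c * fps_X)"

lemma dilate_nth [simp]: "dilate c F $ n = c ^ n * F $ n"
  by (simp add: dilate_def)

lemma dilate_mult:
  fixes F G :: "'b :: idom fps"
  shows "dilate c (F * G) = dilate c F * dilate c G"
  unfolding dilate_def by (rule fps_compose_mult_distrib) simp

lemma dilate_diff: "dilate c (F - G) = dilate c F - dilate c G"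
  by (simp add: fps_eq_iff right_diff_distrib)

lemma dilate_dilate: "dilate c (dilate d F) = dilate (c * d) F"
  by (simp add: fps_eq_iff power_mult_distrib mult_ac)

lemma dilate_linear [simp]: "dilate c (1 + fps_const x * fps_X) = 1 + fps_const (c * x) * fps_X"
  by (auto simp: fps_eq_iff fps_X_def)

lemma dilate_linear' [simp]: "dilate c (1 - fps_const x * fps_X) = 1 - fps_const (c * x) * fps_X"
  by (auto simp: fps_eq_iff fps_X_def)

lemma dilate_compose_X2: "dilate c (F oo fps_X ^ 2) = dilate (c ^ 2) F oo fps_X ^ 2"
  by (auto simp: fps_eq_iff fps_nth_compose_X_power power_mult[symmetric])

lemma compose_X2_mult:
  fixes F G :: "'b :: idom fps"
  shows "(F * G) oo fps_X ^ 2 = (F oo fps_X ^ 2) * (G oo fps_X ^ 2)"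
  by (rule fps_compose_mult_distrib) simp

lemma compose_X2_linear:
  fixes x :: "'b :: idom"
  shows "(1 - fps_const x * fps_X) oo fps_X ^ 2 = 1 - fps_const x * fps_X ^ 2"
  by (simp add: fps_compose_sub_distrib compose_X2_mult)

text \<open>The expansion of (-x z; q)_inf in powers of z. The product is not formed in z; its
  functional equation takes its place.\<close>

definition euler_series :: "'a :: field fps \<Rightarrow> 'a fps \<Rightarrow> 'a fps fps" where
  "euler_series q x = Abs_fps (euler_term q x)"

text \<open>The expansion of 1 / (x z; q)_inf in powers of z, by the companion of Euler's
  identity.\<close>

definition geom_series :: "'a :: field fps \<Rightarrow> 'a fps \<Rightarrow> 'a fps fps" where
  "geom_series q x = Abs_fps (\<lambda>n. x ^ n * inv_qfact q n)"

lemma euler_series_eq: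
  assumes "q $ 0 = 0"
  shows "euler_series q x = (1 + fps_const x * fps_X) * dilate q (euler_series q x)"
proof (rule fps_ext)
  fix n
  show "euler_series q x $ n = ((1 + fps_const x * fps_X) * dilate q (euler_series q x)) $ n"
  proof (cases n)
    case (Suc m)
    have "euler_term q x n = q ^ n * euler_term q x n + x * (q ^ m * euler_term q x m)"
      using euler_term_Suc[OF assms, of x m] unfolding Suc euler_term_scale by (metis diff_eq_eq add.commute)
    then show ?thesis
      by (simp add: Suc euler_series_def distrib_right mult.assoc)
  qed (simp add: euler_series_def)
qed

lemma geom_series_eq:
  assumes "q $ 0 = 0"
  shows "dilate q (geom_series q x) = (1 - fps_const x * fps_X) * geom_series q x"
proof (rule fps_ext)
  fix n
  show "dilate q (geom_series q x) $ n = ((1 - fps_const x * fps_X) * geom_series q x) $ n"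
  proof (cases n)
    case (Suc m)
    have "q ^ n * (x ^ n * inv_qfact q n) =
        x ^ n * inv_qfact q n - x ^ n * ((1 - q ^ n) * inv_qfact q n)"
      by (simp add: algebra_simps)
    also have "x ^ n * ((1 - q ^ n) * inv_qfact q n) = x * (x ^ m * inv_qfact q m)"
      unfolding Suc inv_qfact_Suc[OF assms] by simp
    finally show ?thesis
      by (simp add: Suc geom_series_def left_diff_distrib mult.assoc)
  qed (simp add: geom_series_def left_diff_distrib)
qed

text \<open>For the difference H, once the lower coefficients vanish, the constant terms 1 of P and
  R reduce order n to \<open>H $ n = q ^ n * H $ n\<close>. Since \<open>1 - q ^ n\<close> is
  nonzero for n > 0, the equation and the constant term determine the series.\<close>

lemma dilation_eq_unique:
  fixes F G P R :: "'a :: idom fps fps"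
  assumes "P * F = R * dilate q F" "P * G = R * dilate q G"
    and "P $ 0 = 1" "R $ 0 = 1" "F $ 0 = G $ 0" "q $ 0 = 0"
  shows "F = G"
proof -
  define H where "H = F - G"
  have eq: "P * H = R * dilate q H"
    by (simp add: H_def dilate_diff right_diff_distrib assms)
  have "H $ n = 0" for n
  proof (induction n rule: less_induct)
    case (less n)
    show ?case
    proof (cases "n = 0")
      case False
      have *: "(S * U) $ n = U $ n" if "S $ 0 = 1" "\<And>m. m < n \<Longrightarrow> U $ m = 0" for S U :: "'a fps fps"
      proof -
        have "(S * U) $ n = (\<Sum>i\<in>{0..n}. S $ i * U $ (n - i))" by (rule fps_mult_nth)
        also have "\<dots> = (\<Sum>i\<in>{0}. S $ i * U $ (n - i))"
          by (intro sum.mono_neutral_right) (auto simp: that)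
        finally show ?thesis using that by simp
      qed
      have "H $ n = q ^ n * H $ n"
        using *[of P H] *[of R "dilate q H"] eq less.IH assms by simp
      then have "(1 - q ^ n) * H $ n = 0" by (simp add: algebra_simps)
      moreover have "(1 - q ^ n) $ 0 = 1" using assms False by simp
      then have "1 - q ^ n \<noteq> 0" by (metis fps_zero_nth zero_neq_one)
      ultimately show ?thesis by simp
    qed (simp add: H_def assms)
  qed
  then show ?thesis by (simp add: H_def fps_eq_iff)
qed

section \<open>The series L(z) and its two factorisations\<close>

definition capparelli_series :: "'a :: field fps \<Rightarrow> 'a fps \<Rightarrow> 'a fps \<Rightarrow> 'a fps fps" where
  "capparelli_series q a b = geom_series q q *
     (euler_series q a * (euler_series q b * (geom_series (q ^ 2) q oo fps_X ^ 2)))"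

text \<open>Here \<open>q\<close> plays the role of Q. Replacing z by q z strips the first factor
  from each of the four infinite products; the last has base q^2, which matches z^2 becoming q^2
  z^2.\<close>

lemma capparelli_series_eq:
  assumes "q $ 0 = 0"
  shows "(1 - fps_const q * fps_X) * (1 - fps_const q * fps_X ^ 2) * capparelli_series q a b =
    (1 + fps_const a * fps_X) * (1 + fps_const b * fps_X) * dilate q (capparelli_series q a b)"
proof -
  let ?H = "geom_series (q ^ 2) q"
  have q2: "(q ^ 2) $ 0 = 0" using assms by (simp add: power2_eq_square)
  have H: "dilate q (?H oo fps_X ^ 2) = (1 - fps_const q * fps_X ^ 2) * (?H oo fps_X ^ 2)"
    unfolding dilate_compose_X2 geom_series_eq[OF q2] compose_X2_mult compose_X2_linear ..
  show ?thesis
    unfolding capparelli_series_def dilate_mult H geom_series_eq[OF assms]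
    by (subst (1 2) euler_series_eq[OF assms]) (simp only: mult_ac)
qed

text \<open>Since z^2 becomes q^2 z^2, two factors of (q z^2; q)_inf are stripped. The second, 1 -
  q^2 z^2, splits into linear factors in z, and its part 1 + q z later cancels.\<close>

lemma geom_series_X2_eq:
  assumes "q $ 0 = 0"
  shows "dilate q (geom_series q q oo fps_X ^ 2) =
    (1 - fps_const q * fps_X) * (1 + fps_const q * fps_X) * (1 - fps_const q * fps_X ^ 2) *
    (geom_series q q oo fps_X ^ 2)"
proof -
  let ?H = "geom_series q q"
  have "dilate (q ^ 2) ?H = dilate q (1 - fps_const q * fps_X) * dilate q ?H"
    unfolding power2_eq_square dilate_dilate[symmetric] geom_series_eq[OF assms] dilate_mult ..
  also have "\<dots> = (1 - fps_const (q ^ 2) * fps_X) * (1 - fps_const q * fps_X) * ?H"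
    unfolding dilate_linear' geom_series_eq[OF assms] by (simp add: power2_eq_square mult.assoc)
  finally have "dilate q (?H oo fps_X ^ 2) =
      (1 - fps_const (q ^ 2) * fps_X ^ 2) * (1 - fps_const q * fps_X ^ 2) * (?H oo fps_X ^ 2)"
    unfolding dilate_compose_X2 by (simp only: compose_X2_mult compose_X2_linear)
  also have "1 - fps_const (q ^ 2) * fps_X ^ 2 =
      (1 - fps_const q * fps_X) * (1 + fps_const q * fps_X)"
    by (simp add: algebra_simps power2_eq_square flip: fps_const_mult)
  finally show ?thesis .
qed

lemma euler_series_cube_eq:
  assumes "q $ 0 = 0"
  shows "euler_series q x = (1 + fps_const x * fps_X) * (1 + fps_const (x * q) * fps_X) *
    (1 + fps_const (x * q ^ 2) * fps_X) * dilate (q ^ 3) (euler_series q x)"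
proof -
  have step: "dilate c (euler_series q x) =
      (1 + fps_const (c * x) * fps_X) * dilate (c * q) (euler_series q x)" for c
    by (subst euler_series_eq[OF assms]) (simp add: dilate_mult dilate_dilate)
  show ?thesis
    by (subst euler_series_eq[OF assms], subst step, subst step)
      (simp add: power2_eq_square power3_eq_cube mult_ac)
qed

text \<open>The right-hand side satisfies the functional equation of L for Q = q^3. Its Euler part
  loses the factors 1 + q^k z for k = 2, 3, 4, and the one with k = 3 cancels against the factor 1 +
  Q z produced by the denominator.\<close>

lemma capparelli_series_even:
  fixes q :: "'a :: field fps"
  assumes "q $ 0 = 0"
  shows "capparelli_series (q ^ 3) (q ^ 4) (q ^ 2) =
    euler_series q (q ^ 2) * (geom_series (q ^ 3) (q ^ 3) oo fps_X ^ 2)" (is "?L = ?E * ?H")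
proof -
  let ?q = "q ^ 3"
  let ?l = "\<lambda>k. 1 + fps_const (q ^ k) * fps_X"
  let ?P = "(1 - fps_const ?q * fps_X) * (1 - fps_const ?q * fps_X ^ 2)"
  let ?R = "?l 4 * ?l 2"
  have q3: "?q $ 0 = 0" using assms by (simp add: power3_eq_cube)
  have E: "?E = ?l 2 * ?l 3 * ?l 4 * dilate ?q ?E"
    using euler_series_cube_eq[OF assms, of "q ^ 2"]
    by (simp add: power_Suc2[symmetric] power_add[symmetric] numeral_eq_Suc mult_ac)
  have "?l 3 * (?P * (?E * ?H)) = ?E * dilate ?q ?H"
    unfolding geom_series_X2_eq[OF q3] by (simp only: mult_ac)
  also have "\<dots> = ?l 3 * (?R * (dilate ?q ?E * dilate ?q ?H))"
    by (subst E) (simp only: mult_ac)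
  finally have "?l 3 * (?P * (?E * ?H)) = ?l 3 * (?R * dilate ?q (?E * ?H))"
    by (simp only: dilate_mult)
  moreover have "?l 3 $ 0 \<noteq> 0" by simp
  then have "?l 3 \<noteq> 0" by (metis fps_zero_nth)
  ultimately have eq: "?P * (?E * ?H) = ?R * dilate ?q (?E * ?H)" by simp
  show ?thesis
    by (rule dilation_eq_unique[OF capparelli_series_eq[OF q3] eq])
      (simp_all add: q3 capparelli_series_def euler_series_def geom_series_def)
qed

text \<open>The same argument with k = 3, 4, 5. The extra factor 1 + q z dilates to 1 + q^4 z, which
  absorbs k = 4 and leaves 1 + q z and 1 + q^5 z.\<close>

lemma capparelli_series_odd:
  fixes q :: "'a :: field fps"
  assumes "q $ 0 = 0"
  shows "capparelli_series (q ^ 3) (q ^ 5) q = (1 + fps_const q * fps_X) *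
    (euler_series q (q ^ 3) * (geom_series (q ^ 3) (q ^ 3) oo fps_X ^ 2))" (is "?L = _ * (?E * ?H)")
proof -
  let ?q = "q ^ 3"
  let ?l = "\<lambda>k. 1 + fps_const (q ^ k) * fps_X"
  let ?P = "(1 - fps_const ?q * fps_X) * (1 - fps_const ?q * fps_X ^ 2)"
  let ?R = "?l 5 * ?l 1"
  have q3: "?q $ 0 = 0" using assms by (simp add: power3_eq_cube)
  have E: "?E = ?l 3 * ?l 4 * ?l 5 * dilate ?q ?E"
    using euler_series_cube_eq[OF assms, of "q ^ 3"]
    by (simp add: power_Suc2[symmetric] power_add[symmetric] numeral_eq_Suc mult_ac)
  have l: "dilate ?q (?l 1) = ?l 4"
    by (simp add: numeral_eq_Suc)
  have "?l 3 * (?P * (?l 1 * (?E * ?H))) = ?l 1 * ?E * dilate ?q ?H"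
    unfolding geom_series_X2_eq[OF q3] by (simp only: mult_ac)
  also have "\<dots> = ?l 3 * (?R * (?l 4 * (dilate ?q ?E * dilate ?q ?H)))"
    by (subst E) (simp only: mult_ac)
  finally have "?l 3 * (?P * (?l 1 * (?E * ?H))) = ?l 3 * (?R * dilate ?q (?l 1 * (?E * ?H)))"
    unfolding dilate_mult l .
  moreover have "?l 3 $ 0 \<noteq> 0" by simp
  then have "?l 3 \<noteq> 0" by (metis fps_zero_nth)
  ultimately have eq: "?P * (?l 1 * (?E * ?H)) = ?R * dilate ?q (?l 1 * (?E * ?H))" by simp
  have "?L = ?l 1 * (?E * ?H)"
    using capparelli_series_eq[OF q3, of "q ^ 5" "q ^ 1"]
    by (intro dilation_eq_unique[OF _ eq])
      (simp_all add: q3 capparelli_series_def euler_series_def geom_series_def)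
  then show ?thesis by simp
qed

section \<open>The quadruple sum\<close>

lemma has_sum_monomials:
  fixes \<alpha> :: "nat \<Rightarrow> 'b :: comm_ring_1"
  shows "((\<lambda>n. fps_const (\<alpha> n) * fps_X ^ n) has_sum Abs_fps \<alpha>) UNIV"
  by (rule has_sum_fpsI) (auto simp: fps_X_power_nth intro!: exI[of _ "{_}"])

lemma has_sum_monomials_X2:
  fixes \<alpha> :: "nat \<Rightarrow> 'b :: comm_ring_1"
  shows "((\<lambda>n. fps_const (\<alpha> n) * fps_X ^ (2 * n)) has_sum (Abs_fps \<alpha> oo fps_X ^ 2)) UNIV"
proof (rule has_sum_fpsI)
  fix n :: nat
  show "\<exists>F. finite F \<and> F \<subseteq> UNIV \<and> (\<forall>i\<in>UNIV - F. (fps_const (\<alpha> i) * fps_X ^ (2 * i)) $ n = 0) \<and>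
      (Abs_fps \<alpha> oo fps_X ^ 2) $ n = (\<Sum>i\<in>F. (fps_const (\<alpha> i) * fps_X ^ (2 * i)) $ n)"
    \<comment> \<open>Order n of a series in z^2 receives one monomial for even n and none for odd
      n.\<close>
    by (intro exI[of _ "if even n then {n div 2} else {}"]) (auto simp: fps_X_power_nth fps_nth_compose_X_power)
qed

text \<open>The conclusion depends only on \<open>F\<close>, so two expansions of \<open>F\<close> into monomials lead to equal sums.\<close>

lemma has_sum_substitute_powers:
  fixes \<alpha> :: "'i \<Rightarrow> 'a :: comm_ring_1 fps" and w :: "'i \<Rightarrow> nat"
  assumes "((\<lambda>i. fps_const (\<alpha> i) * fps_X ^ w i) has_sum F) UNIV"
    and "((\<lambda>i. c (w i) * \<alpha> i) has_sum s) UNIV"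
  shows "((\<lambda>N. c N * F $ N) has_sum s) UNIV"
proof (rule has_sum_fps_Sigma)
  \<comment> \<open>The indices are grouped by weight. A fibre may be infinite, but only finitely
    many of its indices have a nonzero coefficient.\<close>
  show "((\<lambda>p. c (fst p) * \<alpha> (snd p)) has_sum s) (Sigma UNIV (\<lambda>N. {i. w i = N}))"
    using assms(2)
    by (subst has_sum_reindex_bij_witness[of _ "\<lambda>i. (w i, i)" snd UNIV "\<lambda>i. c (w i) * \<alpha> i" _ s]) auto
  fix N
  let ?S = "{i. (fps_const (\<alpha> i) * fps_X ^ w i) $ N \<noteq> 0}"
  have S: "?S = {i. w i = N \<and> \<alpha> i \<noteq> 0}"
    by (auto simp: fps_X_power_nth split: if_splits)
  have fin: "finite ?S" and "F $ N = (\<Sum>i\<in>?S. (fps_const (\<alpha> i) * fps_X ^ w i) $ N)"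
    using assms(1) by (simp_all add: has_sum_fps_iff)
  then have "F $ N = (\<Sum>i\<in>?S. \<alpha> i)"
    unfolding S by (simp add: fps_X_power_nth)
  then have "((\<lambda>i. c N * \<alpha> i) has_sum c N * F $ N) ?S"
    using has_sum_finite[OF fin, of \<alpha>] by (intro has_sum_fps_cmult) simp
  then have "((\<lambda>i. c N * \<alpha> i) has_sum c N * F $ N) {i. w i = N}"
    unfolding S by (subst has_sum_cong_neutral[where T = "{i. w i = N \<and> \<alpha> i \<noteq> 0}"]) auto
  then show "((\<lambda>i. c (fst (N, i)) * \<alpha> (snd (N, i))) has_sum c N * F $ N) {i. w i = N}"
    by simp
qed

text \<open>The contribution of terms i, j, k, l of the four factors of
  \<open>capparelli_series\<close>, bracketed as the product is.\<close>

definition quad_coeff :: "'a :: field fps \<Rightarrow> 'a fps \<Rightarrow> 'a fps \<Rightarrow> nat \<times> nat \<times> nat \<times> nat \<Rightarrow> 'a fps" where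
  "quad_coeff q a b = (\<lambda>(i, j, k, l). q ^ i * inv_qfact q i *
     (euler_term q a j * (euler_term q b k * (q ^ l * inv_qfact (q ^ 2) l))))"

definition quad_weight :: "nat \<times> nat \<times> nat \<times> nat \<Rightarrow> nat" where
  "quad_weight = (\<lambda>(i, j, k, l). i + j + k + 2 * l)"

lemma has_sum_capparelli_series:
  "((\<lambda>p. fps_const (quad_coeff q a b p) * fps_X ^ quad_weight p) has_sum capparelli_series q a b) UNIV"
proof -
  have "((\<lambda>p. fps_const (quad_coeff q a b p) * fps_X ^ quad_weight p)
      has_sum capparelli_series q a b) (UNIV \<times> UNIV \<times> UNIV \<times> UNIV)"
    unfolding capparelli_series_def euler_series_def geom_series_def
    by (rule has_sum_cong[THEN iffD1, rotated], (rule has_sum_fps_times has_sum_monomials has_sum_monomials_X2)+)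
      (auto simp: quad_coeff_def quad_weight_def power_add mult_ac simp flip: fps_const_mult)
  then show ?thesis by simp
qed

definition pair_coeff :: "'a :: field fps \<Rightarrow> 'a fps \<Rightarrow> nat \<times> nat \<Rightarrow> 'a fps" where
  "pair_coeff q x = (\<lambda>(i, j). euler_term q x i * ((q ^ 3) ^ j * inv_qfact (q ^ 3) j))"

definition pair_weight :: "nat \<times> nat \<Rightarrow> nat" where
  "pair_weight = (\<lambda>(i, j). i + 2 * j)"

lemma has_sum_pair_series:
  "((\<lambda>p. fps_const (pair_coeff q x p) * fps_X ^ pair_weight p) has_sum
     euler_series q x * (geom_series (q ^ 3) (q ^ 3) oo fps_X ^ 2)) UNIV"
proof -
  have "((\<lambda>p. fps_const (pair_coeff q x p) * fps_X ^ pair_weight p) has_sum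
     euler_series q x * (geom_series (q ^ 3) (q ^ 3) oo fps_X ^ 2)) (UNIV \<times> UNIV)"
    unfolding euler_series_def geom_series_def
    by (rule has_sum_cong[THEN iffD1, rotated], (rule has_sum_fps_times has_sum_monomials has_sum_monomials_X2)+)
      (auto simp: pair_coeff_def pair_weight_def power_add mult_ac simp flip: fps_const_mult)
  then show ?thesis by simp
qed

text \<open>Used to turn quadratic exponents into binomial coefficients, after which comparing
  exponents is linear arithmetic.\<close>

lemma square_eq_choose_2: "n * n = 2 * (n choose 2) + n"
  by (induction n) (simp_all add: Suc_choose_2 del: binomial_Suc_Suc)

lemma quad_term_dvd:
  fixes q a b :: "'a :: field fps"
  assumes "q $ 0 = 0" "a $ 0 = 0" "b $ 0 = 0"
  shows "fps_X ^ (i + j + k + l) dvd c * quad_coeff q a b (i, j, k, l)"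
proof -
  have "fps_X ^ i * (fps_X ^ j * (fps_X ^ k * fps_X ^ l)) dvd quad_coeff q a b (i, j, k, l)"
    unfolding quad_coeff_def prod.case
    by (intro mult_dvd_mono dvd_mult2 euler_term_dvd fps_X_power_dvd_power assms order_refl)
  then show ?thesis by (simp add: power_add mult_ac dvd_mult)
qed

text \<open>In the indices J = j + l and K = k + l the weight is i + J + K. Expanding its binomial
  coefficient isolates an Euler term in i at q^(J+K+1) and a q-Vandermonde term in l.\<close>

lemma quad_term_eq:
  fixes q a b :: "'a :: field fps"
  assumes "a * b = q ^ 2"
  shows "q ^ (quad_weight (i, j, k, l) choose 2) * quad_coeff q a b (i, j, k, l) =
    ((q ^ 2) ^ ((j + l) choose 2) * a ^ (j + l) * ((q ^ 2) ^ ((k + l) choose 2) * b ^ (k + l))) *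
    (euler_term q (q ^ Suc (j + k + 2 * l)) i * vandermonde_term q (j + l) (k + l) l)"
proof -
  \<comment> \<open>The only place where a b = q^2 enters: completing the powers of a and b to J and
    K costs exactly q^(2l).\<close>
  have ab: "a ^ (j + l) * b ^ (k + l) = a ^ j * b ^ k * q ^ (2 * l)"
    unfolding power_mult assms[symmetric] power_mult_distrib power_add by (simp only: mult_ac)
  have V: "vandermonde_term q (j + l) (k + l) l =
      q ^ (j * k) * inv_qfact q j * inv_qfact q k * inv_qfact (q ^ 2) l"
    by (simp add: vandermonde_term_def)
  have exps: "(quad_weight (i, j, k, l) choose 2) + i + (j choose 2) + (k choose 2) + l =
      2 * ((j + l) choose 2) + 2 * ((k + l) choose 2) + 2 * l + (i choose 2)
      + Suc (j + k + 2 * l) * i + j * k"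
  proof -
    have "quad_weight (i, j, k, l) = i + ((j + l) + (k + l))"
      by (simp add: quad_weight_def)
    then show ?thesis
      by (simp add: add_choose_2 algebra_simps square_eq_choose_2)
  qed
  have "q ^ (quad_weight (i, j, k, l) choose 2) * quad_coeff q a b (i, j, k, l) =
      q ^ ((quad_weight (i, j, k, l) choose 2) + i + (j choose 2) + (k choose 2) + l) * (a ^ j * b ^ k) *
      (inv_qfact q i * inv_qfact q j * inv_qfact q k * inv_qfact (q ^ 2) l)"
    by (simp add: quad_coeff_def euler_term_def power_add mult_ac)
  also have "\<dots> = (q ^ (2 * ((j + l) choose 2)) * q ^ (2 * ((k + l) choose 2)) * (a ^ (j + l) * b ^ (k + l)))
      * q ^ (i choose 2) * q ^ (Suc (j + k + 2 * l) * i) * q ^ (j * k) *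
      (inv_qfact q i * inv_qfact q j * inv_qfact q k * inv_qfact (q ^ 2) l)"
    unfolding exps ab by (simp only: power_add mult_ac)
  also have "\<dots> = ((q ^ 2) ^ ((j + l) choose 2) * a ^ (j + l) * ((q ^ 2) ^ ((k + l) choose 2) * b ^ (k + l))) *
    (euler_term q (q ^ Suc (j + k + 2 * l)) i * vandermonde_term q (j + l) (k + l) l)"
    unfolding V euler_term_def power_mult[symmetric] by (simp only: mult_ac)
  finally show ?thesis .
qed

text \<open>For fixed J and K the sum over i gives (-q^(J+K+1); q)_inf and the sum over l gives (-q;
  q)_(J+K) over the q^2-factorials. Their product contains (-q; q)_inf, free of J and K, so the
  outer sum is a product of two Euler sums with base q^2.\<close>

lemma quad_has_sum:
  fixes q a b :: "'a :: field fps"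
  assumes "q $ 0 = 0" "a $ 0 = 0" "b $ 0 = 0" "a * b = q ^ 2"
  shows "((\<lambda>p. q ^ (quad_weight p choose 2) * quad_coeff q a b p) has_sum
    qpochhammer_inf (- q) q * (qpochhammer_inf (- a) (q ^ 2) * qpochhammer_inf (- b) (q ^ 2))) UNIV"
proof -
  define f where "f p = q ^ (quad_weight p choose 2) * quad_coeff q a b p" for p
  define B where "B = (\<lambda>(J, K). qpochhammer_inf (- q) q * (euler_term (q ^ 2) a J * euler_term (q ^ 2) b K))"
  have q2: "(q ^ 2) $ 0 = 0" using assms by (simp add: power2_eq_square)
  have "f summable_on UNIV"
  proof (rule summable_on_fps_dvd)
    show "fps_X ^ (case p of (i, j, k, l) \<Rightarrow> i + j + k + l) dvd f p" for p
      unfolding f_def by (cases p) (simp only: prod.case quad_term_dvd[OF assms(1-3)])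
    fix n :: nat
    have "{p \<in> UNIV. (case p of (i, j, k, l) \<Rightarrow> i + j + k + l) \<le> n}
        \<subseteq> {..n} \<times> {..n} \<times> {..n} \<times> {..n}" by auto
    then show "finite {p \<in> UNIV. (case p of (i, j, k, l) \<Rightarrow> i + j + k + l) \<le> n}"
      by (rule finite_subset) simp
  qed
  then obtain s where s: "(f has_sum s) UNIV" unfolding summable_on_def by blast
  have "(B has_sum s) UNIV"
  proof (rule has_sum_fps_Sigma)
    \<comment> \<open>The range of l is exactly where j = J - l and k = K - l are nonnegative, which
      makes the change of indices bijective.\<close>
    let ?R = "\<lambda>(J, K). (UNIV :: nat set) \<times> {..min J K}"
    show "((\<lambda>((J, K), (i, l)). f (i, J - l, K - l, l)) has_sum s) (Sigma UNIV ?R)"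
      using s
      by (subst has_sum_reindex_bij_witness[where T = UNIV and h = f and s' = s
          and i = "\<lambda>(i, j, k, l). ((j + l, k + l), (i, l))"
          and j = "\<lambda>((J, K), (i, l)). (i, J - l, K - l, l)"]) auto
    fix JK :: "nat \<times> nat"
    obtain J K where JK: "JK = (J, K)" by force
    let ?C = "(q ^ 2) ^ (J choose 2) * a ^ J * ((q ^ 2) ^ (K choose 2) * b ^ K)"
    let ?x = "q ^ Suc (J + K)"
    have x: "?x $ 0 = 0" using assms by simp
    have f: "f (i, J - l, K - l, l) = ?C * (euler_term q ?x i * vandermonde_term q J K l)"
      if "l \<le> min J K" for i l
    proof -
      have "J - l + l = J" "K - l + l = K" "J - l + (K - l) + 2 * l = J + K" using that by auto
      then show ?thesis
        using quad_term_eq[OF assms(4), of i "J - l" "K - l" l] unfolding f_def by simp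
    qed
    have "(\<Sum>l\<le>min J K. vandermonde_term q J K l) = (\<Sum>l\<le>J. vandermonde_term q J K l)"
      by (intro sum.mono_neutral_left) (auto simp: vandermonde_term_def)
    then have V: "(vandermonde_term q J K has_sum
        qpochhammer (- q) q (J + K) * inv_qfact (q ^ 2) J * inv_qfact (q ^ 2) K) {..min J K}"
      using has_sum_finite[of "{..min J K}" "vandermonde_term q J K"]
      by (simp add: sum_vandermonde_term[OF assms(1)])
    have "((\<lambda>p. ?C * (case p of (i, l) \<Rightarrow> euler_term q ?x i * vandermonde_term q J K l)) has_sum
        ?C * (qpochhammer_inf (- ?x) q *
          (qpochhammer (- q) q (J + K) * inv_qfact (q ^ 2) J * inv_qfact (q ^ 2) K))) (UNIV \<times> {..min J K})"
      by (intro has_sum_fps_cmult has_sum_fps_times euler_has_sum V assms x)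
    also have "?C * (qpochhammer_inf (- ?x) q *
          (qpochhammer (- q) q (J + K) * inv_qfact (q ^ 2) J * inv_qfact (q ^ 2) K)) =
        (qpochhammer (- q) q (J + K) * qpochhammer_inf (- q * q ^ (J + K)) q) *
          (euler_term (q ^ 2) a J * euler_term (q ^ 2) b K)"
      by (simp add: euler_term_def mult_ac)
    also have "\<dots> = B JK"
      using qpochhammer_inf_shift[of "- q" q "J + K"] assms(1) by (simp add: B_def JK)
    finally show "((\<lambda>y. (\<lambda>((J, K), (i, l)). f (i, J - l, K - l, l)) (JK, y)) has_sum B JK) (?R JK)"
      unfolding JK prod.case
    proof (rule has_sum_cong[THEN iffD1, rotated])
      fix p assume "p \<in> (UNIV :: nat set) \<times> {..min J K}"
      then obtain i l where p: "p = (i, l)" and l: "l \<le> min J K" by auto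
      show "?C * (case p of (i, l) \<Rightarrow> euler_term q ?x i * vandermonde_term q J K l) =
          (case p of (i, l) \<Rightarrow> f (i, J - l, K - l, l))"
        unfolding p prod.case by (rule f[OF l, symmetric])
    qed
  qed
  moreover have "(B has_sum qpochhammer_inf (- q) q *
      (qpochhammer_inf (- a) (q ^ 2) * qpochhammer_inf (- b) (q ^ 2))) UNIV"
  proof -
    have "((\<lambda>p. qpochhammer_inf (- q) q *
          (case p of (J, K) \<Rightarrow> euler_term (q ^ 2) a J * euler_term (q ^ 2) b K)) has_sum
        qpochhammer_inf (- q) q * (qpochhammer_inf (- a) (q ^ 2) * qpochhammer_inf (- b) (q ^ 2)))
        (UNIV \<times> UNIV)"
      by (intro has_sum_fps_cmult has_sum_fps_times euler_has_sum assms q2)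
    then show ?thesis by (simp add: B_def case_prod_unfold)
  qed
  ultimately have "s = qpochhammer_inf (- q) q *
      (qpochhammer_inf (- a) (q ^ 2) * qpochhammer_inf (- b) (q ^ 2))"
    by (rule has_sum_fps_unique)
  then show ?thesis using s unfolding f_def by simp
qed

section \<open>The double sums\<close>

text \<open>The division is exact because n (n - 1) is even, and truncation at n = 0 is harmless
  because the factor n vanishes.\<close>

lemma three_times_choose_2: "3 * n * (n - 1) div 2 = 3 * (n choose 2)"
  using square_eq_choose_2[of n] by (simp add: mult.assoc right_diff_distrib')

lemma qpochhammer_quotient:
  fixes q :: "'a :: field fps"
  assumes "q $ 0 = 0"
  shows "f / (qpochhammer q q i * qpochhammer (q ^ 3) (q ^ 3) j) = f * (inv_qfact q i * inv_qfact (q ^ 3) j)"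
proof -
  have "(q ^ 3) $ 0 = 0" using assms by (simp add: power3_eq_cube)
  then show ?thesis
    using assms by (simp add: fps_divide_unit fps_inverse_mult inv_qfact_def)
qed

lemma pair_summable:
  fixes q :: "'a :: field fps"
  assumes "q $ 0 = 0" "\<And>i j. i + j \<le> e i j"
  shows "(\<lambda>(i, j). q ^ e i j / (qpochhammer q q i * qpochhammer (q ^ 3) (q ^ 3) j)) summable_on UNIV"
proof (rule summable_on_fps_dvd)
  show "fps_X ^ (fst p + snd p) dvd
      (case p of (i, j) \<Rightarrow> q ^ e i j / (qpochhammer q q i * qpochhammer (q ^ 3) (q ^ 3) j))" for p
    by (cases p) (simp add: qpochhammer_quotient assms fps_X_power_dvd_power dvd_mult2)
  fix n :: nat
  have "{p \<in> UNIV. fst p + snd p \<le> n} \<subseteq> {..n} \<times> {..n}" by auto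
  then show "finite {p \<in> UNIV. fst p + snd p \<le> n}"
    by (rule finite_subset) simp
qed

text \<open>The choices m = 0 and m = 1 give the two double sums without linear shift in j; n = m +
  2 because 2 i^2 exceeds four binomial coefficients by 2 i.\<close>

lemma pair_term_eq:
  fixes q :: "'a :: field fps"
  assumes "q $ 0 = 0" "n = m + 2"
  shows "(q ^ 3) ^ (pair_weight (i, j) choose 2) * pair_coeff q (q ^ n) (i, j) =
    q ^ (2 * i^2 + 6 * i * j + 6 * j^2 + m * i) / (qpochhammer q q i * qpochhammer (q ^ 3) (q ^ 3) j)"
proof -
  have "pair_weight (i, j) = i + (j + j)"
    by (simp add: pair_weight_def)
  then have exps: "2 * i^2 + 6 * i * j + 6 * j^2 + m * i =
      3 * (pair_weight (i, j) choose 2) + (i choose 2) + n * i + 3 * j"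
    by (simp add: assms(2) add_choose_2 power2_eq_square square_eq_choose_2 algebra_simps)
  show ?thesis
    unfolding qpochhammer_quotient[OF assms(1)] exps
    by (simp only: pair_coeff_def euler_term_def prod.case power_add power_mult[symmetric] mult_ac)
qed

text \<open>Two rules suffice: (x; p)_inf (-x; p)_inf = (x^2; p^2)_inf, and (x; p)_inf = (x;
  p^2)_inf (x p; p^2)_inf.\<close>

lemma qpochhammer_inf_even_product:
  fixes q :: "'a :: field fps"
  assumes "q $ 0 = 0"
  shows "qpochhammer_inf (- (q ^ 3)) (q ^ 3) *
      (qpochhammer_inf (- (q ^ 4)) (q ^ 6) * qpochhammer_inf (- (q ^ 2)) (q ^ 6)) =
    1 / qpochhammer_infs [q ^ 2, q ^ 3, q ^ 9, q ^ 10] (q ^ 12)"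
proof -
  \<comment> \<open>The flag \<open>s\<close> records the sign. With exponents as arguments, both
    rules become arithmetic on numerals.\<close>
  define P where "P s a b = qpochhammer_inf (if s then - (q ^ a) else q ^ a) (q ^ b)" for s a b
  have q0: "(q ^ n) $ 0 = 0" if "n > 0" for n using assms that by simp
  have dbl: "P False a b = P False a (b * 2) * P False (a + b) (b * 2)" if "a > 0" "b > 0" for a b
    using qpochhammer_inf_even_odd[of "q ^ a" "q ^ b"] that q0
    by (simp add: P_def power_mult power_add)
  have sqr: "P False a b * P True a b = P False (a * 2) (b * 2)" if "a > 0" "b > 0" for a b
    using qpochhammer_inf_times_uminus[of "q ^ a" "q ^ b"] that q0
    by (simp add: P_def power_mult)
  have nz: "P False a b \<noteq> 0" if "a > 0" "b > 0" for a b
    unfolding P_def using that q0 by (simp add: qpochhammer_inf_nonzero)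
  let ?G = "P False 2 12 * P False 3 12 * P False 9 12 * P False 10 12"
  \<comment> \<open>Each fact absorbs one signed product. The auxiliary factors (q^6; q^6)_inf,
    (q^4; q^12)_inf and (q^8; q^12)_inf reappear permuted on the right and cancel once the three
    facts are multiplied.\<close>
  have 3: "P False 6 6 * (P False 3 12 * P False 9 12) * P True 3 3 = P False 6 6"
    using dbl[of 3 3] dbl[of 3 6] sqr[of 3 3] by (simp add: mult.commute)
  have 4: "P False 4 12 * P False 10 12 * P True 4 6 = P False 8 12"
    using dbl[of 4 6] sqr[of 4 6] by simp
  have 2: "P False 2 12 * P False 8 12 * P True 2 6 = P False 4 12"
    using dbl[of 2 6] sqr[of 2 6] by simp
  have "(P False 6 6 * P False 4 12 * P False 8 12) *
      ((P True 3 3 * (P True 4 6 * P True 2 6)) * ?G) =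
      (P False 6 6 * (P False 3 12 * P False 9 12) * P True 3 3)
      * (P False 4 12 * P False 10 12 * P True 4 6) * (P False 2 12 * P False 8 12 * P True 2 6)"
    by (simp only: mult_ac)
  also have "\<dots> = (P False 6 6 * P False 4 12 * P False 8 12) * 1"
    unfolding 2 3 4 by (simp only: mult_ac mult_1)
  finally have "(P True 3 3 * (P True 4 6 * P True 2 6)) * ?G = 1"
    using nz by (subst (asm) mult_left_cancel) simp_all
  then have "P True 3 3 * (P True 4 6 * P True 2 6) = 1 / ?G"
    using nz by (metis nonzero_mult_div_cancel_right mult_eq_0_iff zero_less_numeral)
  then show ?thesis by (simp add: P_def qpochhammer_infs_def mult_ac)
qed

section \<open>Specialisation and comparison of the expansions\<close>

theorem theorem7p0p1:
  fixes q :: "'a :: field_char_0 fps"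
    and A B C :: "nat \<times> nat \<Rightarrow> 'a fps"
    and D :: "nat \<times> nat \<times> nat \<times> nat \<Rightarrow> 'a fps"
  defines "q \<equiv> fps_X"
    and "A \<equiv> (\<lambda>(i, j). q ^ (2 * i^2 + 6 * i * j + 6 * j^2)
               / (qpochhammer q q i * qpochhammer (q ^ 3) (q ^ 3) j))"
    and "B \<equiv> (\<lambda>(i, j). q ^ (2 * i^2 + 6 * i * j + 6 * j^2 + i)
               / (qpochhammer q q i * qpochhammer (q ^ 3) (q ^ 3) j))"
    and "C \<equiv> (\<lambda>(i, j). q ^ (2 * i^2 + 6 * i * j + 6 * j^2 + 4 * i + 6 * j + 1)
               / (qpochhammer q q i * qpochhammer (q ^ 3) (q ^ 3) j))"
    and "D \<equiv> (\<lambda>(i, j, k, l).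
               q ^ (3 * (i + j + k + 2 * l) * (i + j + k + 2 * l - 1) div 2
                    + 3 * i + 5 * j + 3 * j * (j - 1) div 2 + k + 3 * k * (k - 1) div 2 + 3 * l)
               / (qpochhammer (q ^ 3) (q ^ 3) i * qpochhammer (q ^ 3) (q ^ 3) j
                  * qpochhammer (q ^ 3) (q ^ 3) k * qpochhammer (q ^ 6) (q ^ 6) l))"
  shows "A summable_on UNIV
       \<and> (\<Sum>\<^sub>\<infinity>ij. A ij) = 1 / qpochhammer_infs [q ^ 2, q ^ 3, q ^ 9, q ^ 10] (q ^ 12)
       \<and> B summable_on UNIV \<and> C summable_on UNIV \<and> D summable_on UNIV
       \<and> (\<Sum>\<^sub>\<infinity>ijkl. D ijkl) = (\<Sum>\<^sub>\<infinity>ij. B ij) + (\<Sum>\<^sub>\<infinity>ij. C ij)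
       \<and> (\<Sum>\<^sub>\<infinity>ij. B ij) + (\<Sum>\<^sub>\<infinity>ij. C ij)
           = qpochhammer_infs [- q, - (q ^ 3), - (q ^ 5), - (q ^ 6)] (q ^ 6)"
proof -
  have q: "q $ 0 = 0" by (simp add: q_def)
  \<comment> \<open>The value that replaces z^N, with Q = q^3.\<close>
  define c where "c N = (q ^ 3) ^ (N choose 2)" for N
  have le: "i + j \<le> 2 * i^2 + 6 * i * j + 6 * j^2" for i j :: nat
    using le_square[of i] le_square[of j] le0[of "6 * i * j"]
    unfolding power2_eq_square by linarith
  have sumA: "A summable_on UNIV" and sumB: "B summable_on UNIV" and sumC: "C summable_on UNIV"
    unfolding A_def B_def C_def by (rule pair_summable[OF q]; use le in \<open>simp add: trans_le_add1\<close>)+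

  have A: "A p = c (pair_weight p) * pair_coeff q (q ^ 2) p" for p
    using pair_term_eq[OF q, of 2 0 "fst p" "snd p"] by (simp add: A_def c_def case_prod_unfold)
  have B: "B p = c (pair_weight p) * pair_coeff q (q ^ 3) p" for p
    using pair_term_eq[OF q, of 3 1 "fst p" "snd p"] by (simp add: B_def c_def case_prod_unfold)
  have C: "C p = c (Suc (pair_weight p)) * (q * pair_coeff q (q ^ 3) p)" for p
  proof -
    obtain i j where p: "p = (i, j)" by force
    \<comment> \<open>The excess over the exponent of \<open>B\<close> is one plus three times the
      weight. Passing from \<open>c N\<close> to \<open>c (Suc N)\<close> accounts for the latter,
      and the remaining q is the coefficient of q z.\<close>
    have exps: "2 * i^2 + 6 * i * j + 6 * j^2 + 4 * i + 6 * j + 1 =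
        3 * pair_weight (i, j) + Suc (2 * i^2 + 6 * i * j + 6 * j^2 + i)"
      by (simp add: pair_weight_def)
    have "C p = (q ^ 3) ^ pair_weight p * (q * B p)"
      unfolding B_def C_def p prod.case exps qpochhammer_quotient[OF q]
      by (simp only: power_mult[symmetric] power_add power_Suc mult_ac)
    then show ?thesis
      by (simp add: B c_def Suc_choose_2 power_add mult_ac del: binomial_Suc_Suc)
  qed
  have D: "D p = c (quad_weight p) * quad_coeff (q ^ 3) (q ^ 5) q p" for p
  proof -
    obtain i j k l where p: "p = (i, j, k, l)" by (cases p)
    have "D p = q ^ (3 * (quad_weight p choose 2)
        + 3 * i + 5 * j + 3 * (j choose 2) + k + 3 * (k choose 2) + 3 * l) *
      (inv_qfact (q ^ 3) i * inv_qfact (q ^ 3) j * inv_qfact (q ^ 3) k * inv_qfact (q ^ 6) l)"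
      unfolding D_def p prod.case three_times_choose_2
      by (simp add: fps_divide_unit fps_inverse_mult inv_qfact_def q quad_weight_def)
    moreover have "(q ^ 3) ^ 2 = q ^ 6" by (simp flip: power_mult)
    ultimately show ?thesis
      unfolding p c_def quad_coeff_def euler_term_def prod.case
      by (simp only: power_add power_mult[symmetric] mult_ac)
  qed

  have even: "((\<lambda>N. c N * capparelli_series (q ^ 3) (q ^ 4) (q ^ 2) $ N) has_sum
      1 / qpochhammer_infs [q ^ 2, q ^ 3, q ^ 9, q ^ 10] (q ^ 12)) UNIV"
    unfolding qpochhammer_inf_even_product[OF q, symmetric] c_def
    using quad_has_sum[of "q ^ 3" "q ^ 4" "q ^ 2"] q
    by (intro has_sum_substitute_powers[OF has_sum_capparelli_series])
      (simp flip: power_mult power_add)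
  \<comment> \<open>The same series, now expanded through its other factorisation, whose substituted
    terms are those of \<open>A\<close>.\<close>
  have "((\<lambda>N. c N * capparelli_series (q ^ 3) (q ^ 4) (q ^ 2) $ N) has_sum infsum A UNIV) UNIV"
    unfolding capparelli_series_even[OF q]
    by (rule has_sum_substitute_powers[OF has_sum_pair_series])
      (use has_sum_infsum[OF sumA] in \<open>simp add: A[abs_def]\<close>)
  then have A_eq: "infsum A UNIV = 1 / qpochhammer_infs [q ^ 2, q ^ 3, q ^ 9, q ^ 10] (q ^ 12)"
    using even by (rule has_sum_fps_unique)

  let ?F = "euler_series q (q ^ 3) * (geom_series (q ^ 3) (q ^ 3) oo fps_X ^ 2)"
  let ?P = "qpochhammer_infs [- q, - (q ^ 3), - (q ^ 5), - (q ^ 6)] (q ^ 6)"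
  \<comment> \<open>Splitting (-q^3; q^3)_inf by parity supplies the factors with q^3 and
    q^6.\<close>
  have P: "qpochhammer_inf (- (q ^ 3)) (q ^ 3) *
      (qpochhammer_inf (- (q ^ 5)) (q ^ 6) * qpochhammer_inf (- q) (q ^ 6)) = ?P"
    using qpochhammer_inf_even_odd[of "- (q ^ 3)" "q ^ 3"] q
    by (simp add: qpochhammer_infs_def mult_ac flip: power_mult power_add)
  have D_sum: "(D has_sum ?P) UNIV"
    using quad_has_sum[of "q ^ 3" "q ^ 5" q] q
    unfolding P[symmetric] D[abs_def] c_def
    by (simp add: power_Suc2[symmetric] flip: power_mult)
  then have odd: "((\<lambda>N. c N * capparelli_series (q ^ 3) (q ^ 5) q $ N) has_sum ?P) UNIV"
    unfolding D[abs_def] by (rule has_sum_substitute_powers[OF has_sum_capparelli_series])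
  have "((\<lambda>N. c N * ?F $ N) has_sum infsum B UNIV) UNIV"
    by (rule has_sum_substitute_powers[OF has_sum_pair_series])
      (use has_sum_infsum[OF sumB] in \<open>simp add: B[abs_def]\<close>)
  \<comment> \<open>In (1 + q z) \<open>?F\<close> the summand 1 yields \<open>B\<close>; the
    summand q z raises the weight by one and yields \<open>C\<close>.\<close>
  moreover have "((\<lambda>N. c N * (fps_const q * fps_X * ?F) $ N) has_sum infsum C UNIV) UNIV"
  proof (rule has_sum_substitute_powers)
    show "((\<lambda>p. fps_const (q * pair_coeff q (q ^ 3) p) * fps_X ^ Suc (pair_weight p)) has_sum
        fps_const q * fps_X * ?F) UNIV"
      using has_sum_fps_cmult[OF has_sum_pair_series, of "fps_const q * fps_X" q "q ^ 3"]
      by (simp add: mult_ac flip: fps_const_mult)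
    show "((\<lambda>p. c (Suc (pair_weight p)) * (q * pair_coeff q (q ^ 3) p)) has_sum infsum C UNIV) UNIV"
      using has_sum_infsum[OF sumC] by (simp add: C[abs_def])
  qed
  ultimately have "((\<lambda>N. c N * ?F $ N + c N * (fps_const q * fps_X * ?F) $ N) has_sum
      infsum B UNIV + infsum C UNIV) UNIV"
    by (rule has_sum_fps_add)
  also have "(\<lambda>N. c N * ?F $ N + c N * (fps_const q * fps_X * ?F) $ N) =
      (\<lambda>N. c N * capparelli_series (q ^ 3) (q ^ 5) q $ N)"
    unfolding capparelli_series_odd[OF q] by (simp only: distrib_right mult_1 fps_add_nth distrib_left)
  finally have BC: "infsum B UNIV + infsum C UNIV = ?P"
    using odd by (rule has_sum_fps_unique)
  moreover have "D summable_on UNIV" using D_sum unfolding summable_on_def by blast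
  moreover have "infsum D UNIV = ?P" using D_sum by (rule infsumI)
  ultimately show ?thesis using sumA sumB sumC A_eq by simp
qed

end
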